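(* Let $E$ be a semilattice and let $G$ be a group acting on the left on $E$ by means of a locally finite action $\theta\colon G\to \mathrm{Aut}(E)$. Then the following conditions are equivalent: (i) the semidirect product $E\ast_\theta G$ is a Howson inverse semigroup; (ii) $G$ is a Howson group.
   Context: A semilattice is a (nonempty) meet-semilattice $(E,\wedge)$, and $\mathrm{Aut}(E)$ is its group of semilattice automorphisms. A left action of a group $G$ on $E$ is a group homomorphism $\theta\colon G\to\mathrm{Aut}(E)$, $g\mapsto\theta_g$; write $g\cdot e=\theta_g(e)$. The semidirect product $E\ast_\theta G$ is the set $E\times G$ with multiplication $(e,g)(f,h)=(e\wedge(g\cdot f),gh)$; it is an inverse semigroup with $(e,g)^{-1}=(g^{-1}\cdot e,g^{-1})$. The action is locally finite if, for every finitely generated subgroup $H\le G$ and every $e\in E$, the orbit $H\cdot e=\{h\cdot e : h\in H\}$ is finite. A group is a Howson group if the intersection of any two of its finitely generated subgroups is finitely generated. An inverse semigroup $S$ is a Howson inverse semigroup if the intersection of any two finitely generated inverse subsemigroups of $S$ is finitely generated (as an inverse semigroup); an empty intersection counts as finitely generated (by the empty set). *)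

theory Defs
  imports "HOL-Algebra.Group_Action" "HOL-Algebra.Generated_Groups"
begin

section \<open>Howson groups\<close>

definition fg_subgroup :: "('g, 'm) monoid_scheme \<Rightarrow> 'g set \<Rightarrow> bool" where
  "fg_subgroup G H \<longleftrightarrow> (\<exists>A. finite A \<and> A \<subseteq> carrier G \<and> H = generate G A)"

locale howson_group = group G for G (structure) +
  assumes fg_Int: "\<lbrakk>fg_subgroup G H; fg_subgroup G K\<rbrakk> \<Longrightarrow> fg_subgroup G (H \<inter> K)"

section \<open>Howson inverse semigroups\<close>

text \<open>The record \<^typ>\<open>'a monoid\<close> has a field for the unit, which an inverse
  semigroup need not have.\<close>

record 'a semigrp = "'a partial_object" +
  sg_mult :: "'a \<Rightarrow> 'a \<Rightarrow> 'a" (infixl \<open>\<cdot>\<index>\<close> 70)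

locale inverse_semigroup =
  fixes S (structure)
  assumes sg_mult_closed: "\<lbrakk>x \<in> carrier S; y \<in> carrier S\<rbrakk> \<Longrightarrow> x \<cdot> y \<in> carrier S"
    and sg_mult_assoc: "\<lbrakk>x \<in> carrier S; y \<in> carrier S; z \<in> carrier S\<rbrakk>
          \<Longrightarrow> (x \<cdot> y) \<cdot> z = x \<cdot> (y \<cdot> z)"
    and ex1_inverse: "x \<in> carrier S \<Longrightarrow> \<exists>!y. y \<in> carrier S \<and> x \<cdot> y \<cdot> x = x \<and> y \<cdot> x \<cdot> y = y"

definition sinv :: "('a, 'm) semigrp_scheme \<Rightarrow> 'a \<Rightarrow> 'a" where
  "sinv S x = (THE y. y \<in> carrier S \<and> x \<cdot>\<^bsub>S\<^esub> y \<cdot>\<^bsub>S\<^esub> x = x \<and> y \<cdot>\<^bsub>S\<^esub> x \<cdot>\<^bsub>S\<^esub> y = y)"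

text \<open>The inverse subsemigroup generated by \<open>A\<close>; it is empty if \<open>A\<close> is.\<close>

inductive_set inv_generate :: "('a, 'm) semigrp_scheme \<Rightarrow> 'a set \<Rightarrow> 'a set"
  for S (structure) and A where
    incl: "x \<in> A \<Longrightarrow> x \<in> inv_generate S A"
  | inv: "x \<in> inv_generate S A \<Longrightarrow> sinv S x \<in> inv_generate S A"
  | mult: "x \<in> inv_generate S A \<Longrightarrow> y \<in> inv_generate S A \<Longrightarrow> x \<cdot> y \<in> inv_generate S A"

definition fg_inverse_subsemigroup :: "('a, 'm) semigrp_scheme \<Rightarrow> 'a set \<Rightarrow> bool" where
  "fg_inverse_subsemigroup S T \<longleftrightarrow>
     (\<exists>A. finite A \<and> A \<subseteq> carrier S \<and> T = inv_generate S A)"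

locale howson_inverse_semigroup = inverse_semigroup S for S (structure) +
  assumes fg_Int: "\<lbrakk>fg_inverse_subsemigroup S T; fg_inverse_subsemigroup S U\<rbrakk>
    \<Longrightarrow> fg_inverse_subsemigroup S (T \<inter> U)"

section \<open>Actions on semilattices and semidirect products\<close>

definition meet_auto :: "('e, 'm) gorder_scheme \<Rightarrow> ('e \<Rightarrow> 'e) set" where
  "meet_auto E = {f \<in> Bij (carrier E).
     \<forall>x\<in>carrier E. \<forall>y\<in>carrier E. f (x \<sqinter>\<^bsub>E\<^esub> y) = f x \<sqinter>\<^bsub>E\<^esub> f y}"

definition MeetAutoGroup :: "('e, 'm) gorder_scheme \<Rightarrow> ('e \<Rightarrow> 'e) monoid" where
  "MeetAutoGroup E = BijGroup (carrier E) \<lparr>carrier := meet_auto E\<rparr>"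

lemma group_MeetAutoGroup:
  assumes "lower_semilattice E"
  shows "group (MeetAutoGroup E)"
proof -
  interpret lower_semilattice E by fact
  have mem: "f x \<in> carrier E" if "f \<in> Bij (carrier E)" "x \<in> carrier E" for f x
    using Bij_imp_funcset[OF that(1)] that(2) by auto
  have "subgroup (meet_auto E) (BijGroup (carrier E))"
  proof (rule subgroup.intro)
    show "meet_auto E \<subseteq> carrier (BijGroup (carrier E))"
      by (auto simp: meet_auto_def BijGroup_def)
    show "\<one>\<^bsub>BijGroup (carrier E)\<^esub> \<in> meet_auto E"
      by (simp add: meet_auto_def BijGroup_def id_Bij)
    show "f \<otimes>\<^bsub>BijGroup (carrier E)\<^esub> g \<in> meet_auto E"
      if "f \<in> meet_auto E" "g \<in> meet_auto E" for f g
      using that by (simp add: meet_auto_def BijGroup_def compose_Bij compose_eq mem)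
    show "inv\<^bsub>BijGroup (carrier E)\<^esub> f \<in> meet_auto E" if "f \<in> meet_auto E" for f
      using that
      by (auto simp: meet_auto_def inv_BijGroup restrict_inv_into_Bij intro!: Bij_inv_into_lemma)
  qed
  then show ?thesis
    unfolding MeetAutoGroup_def by (rule subgroup.subgroup_is_group[OF _ group_BijGroup])
qed

definition locally_finite_action ::
    "('e, 'm) gorder_scheme \<Rightarrow> ('g, 'n) monoid_scheme \<Rightarrow> ('g \<Rightarrow> 'e \<Rightarrow> 'e) \<Rightarrow> bool" where
  "locally_finite_action E G \<theta> \<longleftrightarrow>
     (\<forall>H. fg_subgroup G H \<longrightarrow> (\<forall>e\<in>carrier E. finite (orbit (G\<lparr>carrier := H\<rparr>) \<theta> e)))"

definition semidirect_product ::
    "('e, 'm) gorder_scheme \<Rightarrow> ('g, 'n) monoid_scheme \<Rightarrow> ('g \<Rightarrow> 'e \<Rightarrow> 'e) \<Rightarrow> ('e \<times> 'g) semigrp" where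
  "semidirect_product E G \<theta> =
     \<lparr>carrier = carrier E \<times> carrier G,
      sg_mult = (\<lambda>(e, g) (f, h). (e \<sqinter>\<^bsub>E\<^esub> \<theta> g f, g \<otimes>\<^bsub>G\<^esub> h))\<rparr>"

end

theory Submission
  imports Defs
begin

text \<open>Read an inverse subsemigroup \<open>V\<close> of \<open>E * G\<close> as a groupoid on the set \<open>fst ` V\<close>, the element
  \<open>(e, g)\<close> being an arrow between \<open>e\<close> and \<open>g\<inverse> \<cdot> e\<close>. If \<open>fst ` V\<close> is finite and the isotropy groups
  \<open>{g. (e, g) \<in> V \<and> g \<cdot> e = e}\<close> are finitely generated, then \<open>V\<close> is finitely generated, by generators of
  the isotropy groups and one arrow for each connected pair of objects. Conversely, local finiteness
  makes \<open>fst ` V\<close> finite for a finitely generated \<open>V\<close>, and Schreier's argument shows that its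
  isotropy groups are finitely generated. Since the isotropy groups of \<open>T \<inter> U\<close> are the intersections of
  those of \<open>T\<close> and \<open>U\<close>, the Howson property passes from \<open>G\<close> to \<open>E * G\<close>. In the other direction, the meet
  \<open>f\<close> of a finite orbit under a finitely generated group is a fixed point, and the subgroups \<open>H\<close> and \<open>K\<close>
  are recovered from the inverse subsemigroups \<open>{f} \<times> H\<close> and \<open>{f} \<times> K\<close>.\<close>

section \<open>Inverse subsemigroups and generation\<close>

definition inverse_subsemigroup :: "('a, 'm) semigrp_scheme \<Rightarrow> 'a set \<Rightarrow> bool" where
  "inverse_subsemigroup S V \<longleftrightarrow> V \<subseteq> carrier S \<and> (\<forall>p\<in>V. sinv S p \<in> V) \<and>
     (\<forall>p\<in>V. \<forall>q\<in>V. p \<cdot>\<^bsub>S\<^esub> q \<in> V)"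

lemma inverse_subsemigroup_Int:
  "inverse_subsemigroup S V \<Longrightarrow> inverse_subsemigroup S W \<Longrightarrow> inverse_subsemigroup S (V \<inter> W)"
  by (auto simp: inverse_subsemigroup_def)

lemma inv_generate_subset:
  assumes "inverse_subsemigroup S V" "A \<subseteq> V"
  shows "inv_generate S A \<subseteq> V"
proof
  show "p \<in> V" if "p \<in> inv_generate S A" for p
    using that assms by induction (auto simp: inverse_subsemigroup_def)
qed

lemma fg_subgroupD: "group G \<Longrightarrow> fg_subgroup G H \<Longrightarrow> subgroup H G"
  by (auto simp: fg_subgroup_def intro: group.generate_is_subgroup)

section \<open>Group actions on semilattices and the semidirect product\<close>

locale semilattice_action = lower_semilattice E + group G
  for E :: "('e, 'm) gorder_scheme" and G :: "('g, 'n) monoid_scheme" (structure)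
    and \<theta> :: "'g \<Rightarrow> 'e \<Rightarrow> 'e" +
  assumes hom: "group_hom G (MeetAutoGroup E) \<theta>"
begin

abbreviation S :: "('e \<times> 'g) semigrp" where "S \<equiv> semidirect_product E G \<theta>"

lemma act_meet_auto: "g \<in> carrier G \<Longrightarrow> \<theta> g \<in> meet_auto E"
  using group_hom.hom_closed[OF hom] by (simp add: MeetAutoGroup_def)

lemma act_closed [simp]: "g \<in> carrier G \<Longrightarrow> x \<in> carrier E \<Longrightarrow> \<theta> g x \<in> carrier E"
  using act_meet_auto[of g] Bij_imp_funcset[of "\<theta> g" "carrier E"]
  by (auto simp: meet_auto_def)

lemma act_meet:
  "g \<in> carrier G \<Longrightarrow> x \<in> carrier E \<Longrightarrow> y \<in> carrier E \<Longrightarrow> \<theta> g (x \<sqinter>\<^bsub>E\<^esub> y) = \<theta> g x \<sqinter>\<^bsub>E\<^esub> \<theta> g y"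
  using act_meet_auto[of g] by (auto simp: meet_auto_def)

lemma act_mult:
  assumes "g \<in> carrier G" "h \<in> carrier G" "x \<in> carrier E"
  shows "\<theta> (g \<otimes> h) x = \<theta> g (\<theta> h x)"
proof -
  have "\<theta> g \<in> Bij (carrier E)" "\<theta> h \<in> Bij (carrier E)"
    using act_meet_auto assms by (auto simp: meet_auto_def)
  then show ?thesis
    using group_hom.hom_mult[OF hom assms(1,2)] assms
    by (simp add: MeetAutoGroup_def BijGroup_def compose_eq)
qed

lemma act_one [simp]: "x \<in> carrier E \<Longrightarrow> \<theta> \<one> x = x"
  using group_hom.hom_one[OF hom] by (simp add: MeetAutoGroup_def BijGroup_def)

lemma act_inv_act [simp]:
  "g \<in> carrier G \<Longrightarrow> x \<in> carrier E \<Longrightarrow> \<theta> (inv g) (\<theta> g x) = x"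
  "g \<in> carrier G \<Longrightarrow> x \<in> carrier E \<Longrightarrow> \<theta> g (\<theta> (inv g) x) = x"
  by (simp_all flip: act_mult)

lemma meet_eq_left_iff:
  "x \<in> carrier E \<Longrightarrow> y \<in> carrier E \<Longrightarrow> x \<sqinter>\<^bsub>E\<^esub> y = x \<longleftrightarrow> x \<sqsubseteq>\<^bsub>E\<^esub> y"
  by (metis le_antisym meet_closed meet_le meet_left meet_right local.le_refl)

lemma meet_self [simp]: "x \<in> carrier E \<Longrightarrow> x \<sqinter>\<^bsub>E\<^esub> x = x"
  by (simp add: meet_eq_left_iff)

lemma act_le:
  assumes "g \<in> carrier G" "x \<in> carrier E" "y \<in> carrier E" "x \<sqsubseteq>\<^bsub>E\<^esub> y"
  shows "\<theta> g x \<sqsubseteq>\<^bsub>E\<^esub> \<theta> g y"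
  using assms act_meet[of g x y] by (metis act_closed meet_eq_left_iff)

lemma act_le_iff:
  assumes "g \<in> carrier G" "x \<in> carrier E" "y \<in> carrier E"
  shows "\<theta> (inv g) x \<sqsubseteq>\<^bsub>E\<^esub> y \<longleftrightarrow> x \<sqsubseteq>\<^bsub>E\<^esub> \<theta> g y"
  using assms act_le[of g "\<theta> (inv g) x" y] act_le[of "inv g" x "\<theta> g y"] by auto

lemma carrier_S: "carrier S = carrier E \<times> carrier G"
  by (simp add: semidirect_product_def)

lemma mult_S: "(e, g) \<cdot>\<^bsub>S\<^esub> (f, h) = (e \<sqinter>\<^bsub>E\<^esub> \<theta> g f, g \<otimes> h)"
  by (simp add: semidirect_product_def)

text \<open>Cancellation in \<open>G\<close> forces the second component. The equations on first
  components then say that \<open>e\<close> lies below \<open>\<theta> g f\<close> and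
  \<open>f\<close> below \<open>\<theta> (inv g) e\<close>; applying \<open>inv g\<close> to the
  first inequality gives the converse of the second. The equivalence yields existence, uniqueness
  and the value of \<open>sinv\<close> at once.\<close>

lemma S_inverse_iff:
  assumes "e \<in> carrier E" "g \<in> carrier G"
  shows "p \<in> carrier S \<and> (e, g) \<cdot>\<^bsub>S\<^esub> p \<cdot>\<^bsub>S\<^esub> (e, g) = (e, g) \<and> p \<cdot>\<^bsub>S\<^esub> (e, g) \<cdot>\<^bsub>S\<^esub> p = p
    \<longleftrightarrow> p = (\<theta> (inv g) e, inv g)"
proof (cases p)
  case (Pair f h)
  show ?thesis
  proof
    assume *: "p \<in> carrier S \<and> (e, g) \<cdot>\<^bsub>S\<^esub> p \<cdot>\<^bsub>S\<^esub> (e, g) = (e, g) \<and> p \<cdot>\<^bsub>S\<^esub> (e, g) \<cdot>\<^bsub>S\<^esub> p = p"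
    then have c: "f \<in> carrier E" "h \<in> carrier G"
      by (auto simp: Pair carrier_S)
    from * have "g \<otimes> h \<otimes> g = g" by (auto simp: Pair mult_S)
    then have "g \<otimes> (h \<otimes> g) = g" using assms c by (simp add: m_assoc)
    then have "h \<otimes> g = \<one>" using assms c by simp
    then have h: "h = inv g" using assms c by (metis inv_equality)
    from * have e: "e \<sqinter>\<^bsub>E\<^esub> \<theta> g f \<sqinter>\<^bsub>E\<^esub> e = e" and f: "f \<sqinter>\<^bsub>E\<^esub> \<theta> (inv g) e \<sqinter>\<^bsub>E\<^esub> f = f"
      using assms c by (auto simp: Pair mult_S h)
    have "e \<sqsubseteq>\<^bsub>E\<^esub> \<theta> g f" "f \<sqsubseteq>\<^bsub>E\<^esub> \<theta> (inv g) e"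
      using e f assms c by (metis act_closed inv_closed meet_closed meet_assoc meet_comm meet_left meet_right le_trans)+
    then have "f = \<theta> (inv g) e"
      using assms c act_le_iff[of g e f] by (simp add: le_antisym)
    then show "p = (\<theta> (inv g) e, inv g)" by (simp add: Pair h)
  next
    assume "p = (\<theta> (inv g) e, inv g)"
    then show "p \<in> carrier S \<and> (e, g) \<cdot>\<^bsub>S\<^esub> p \<cdot>\<^bsub>S\<^esub> (e, g) = (e, g) \<and> p \<cdot>\<^bsub>S\<^esub> (e, g) \<cdot>\<^bsub>S\<^esub> p = p"
      using assms by (simp add: carrier_S mult_S)
  qed
qed

lemma sinv_S: "e \<in> carrier E \<Longrightarrow> g \<in> carrier G \<Longrightarrow> sinv S (e, g) = (\<theta> (inv g) e, inv g)"
  by (simp add: sinv_def S_inverse_iff)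

lemma inverse_semigroup_S: "inverse_semigroup S"
proof
  show "\<exists>!y. y \<in> carrier S \<and> x \<cdot>\<^bsub>S\<^esub> y \<cdot>\<^bsub>S\<^esub> x = x \<and> y \<cdot>\<^bsub>S\<^esub> x \<cdot>\<^bsub>S\<^esub> y = y" if "x \<in> carrier S" for x
  proof (cases x)
    case (Pair e g)
    with that have "e \<in> carrier E" "g \<in> carrier G" by (simp_all add: carrier_S)
    then show ?thesis unfolding Pair by (subst S_inverse_iff) simp_all
  qed
qed (auto simp: carrier_S mult_S act_meet act_mult meet_assoc m_assoc)

lemma inverse_subsemigroup_iff:
  "inverse_subsemigroup S V \<longleftrightarrow> V \<subseteq> carrier E \<times> carrier G \<and>
     (\<forall>(e, g)\<in>V. (\<theta> (inv g) e, inv g) \<in> V) \<and>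
     (\<forall>(e, g)\<in>V. \<forall>(f, h)\<in>V. (e \<sqinter>\<^bsub>E\<^esub> \<theta> g f, g \<otimes> h) \<in> V)"
  unfolding inverse_subsemigroup_def carrier_S
  by (fastforce simp: sinv_S mult_S)

lemma inverse_subsemigroup_generate:
  assumes "A \<subseteq> carrier S"
  shows "inverse_subsemigroup S (inv_generate S A)"
proof -
  have "p \<in> carrier S" if "p \<in> inv_generate S A" for p
    using that
  proof induction
    case (inv p)
    then show ?case by (cases p) (auto simp: carrier_S sinv_S)
  next
    case (mult p q)
    then show ?case by (cases p, cases q) (auto simp: carrier_S mult_S)
  qed (use assms in auto)
  then show ?thesis
    by (simp add: inverse_subsemigroup_def subset_iff inv_generate.inv inv_generate.mult)
qed

section \<open>Isotropy groups of an inverse subsemigroup\<close>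

definition isotropy :: "('e \<times> 'g) set \<Rightarrow> 'e \<Rightarrow> 'g set" where
  "isotropy V e = {g. (e, g) \<in> V \<and> \<theta> g e = e}"

context
  fixes V
  assumes V: "inverse_subsemigroup S V"
begin

lemma sub_closed: "(e, g) \<in> V \<Longrightarrow> e \<in> carrier E" "(e, g) \<in> V \<Longrightarrow> g \<in> carrier G"
  using V by (auto simp: inverse_subsemigroup_iff)

lemma sub_inv: "(e, g) \<in> V \<Longrightarrow> (\<theta> (inv g) e, inv g) \<in> V"
  using V by (auto simp: inverse_subsemigroup_iff)

lemma sub_mult: "(e, g) \<in> V \<Longrightarrow> (f, h) \<in> V \<Longrightarrow> (e \<sqinter>\<^bsub>E\<^esub> \<theta> g f, g \<otimes> h) \<in> V"
  using V by (auto simp: inverse_subsemigroup_iff)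

text \<open>Composition of arrows with restriction built in: the object \<open>f\<close> need only
  lie above the end \<open>\<theta> (inv g) e\<close> of \<open>(e, g)\<close>, since the meet then
  leaves \<open>e\<close> unchanged.\<close>

lemma sub_extend:
  assumes "(e, g) \<in> V" "(f, h) \<in> V" "e \<sqsubseteq>\<^bsub>E\<^esub> \<theta> g f"
  shows "(e, g \<otimes> h) \<in> V"
proof -
  have "e \<sqinter>\<^bsub>E\<^esub> \<theta> g f = e"
    using assms sub_closed by (simp add: meet_eq_left_iff)
  then show ?thesis using sub_mult[OF assms(1,2)] by simp
qed

text \<open>Two arrows with the same ends differ by a loop: follow \<open>(e, g)\<close>, then the
  inverse of \<open>(e, h)\<close>.\<close>

lemma sub_div:
  assumes "(e, g) \<in> V" "(e, h) \<in> V" "\<theta> (inv g) e = \<theta> (inv h) e"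
  shows "g \<otimes> inv h \<in> isotropy V e"
proof -
  note c = sub_closed[OF assms(1)] sub_closed[OF assms(2)]
  have g: "\<theta> g (\<theta> (inv h) e) = e"
    using c by (simp flip: assms(3))
  then have "(e, g \<otimes> inv h) \<in> V"
    using sub_extend[OF assms(1) sub_inv[OF assms(2)]] c by simp
  then show ?thesis
    using g c by (simp add: isotropy_def act_mult)
qed

text \<open>The case \<open>g = h\<close> of \<open>sub_div\<close>: an arrow followed by its own
  inverse.\<close>

lemma sub_one: "e \<in> fst ` V \<Longrightarrow> (e, \<one>) \<in> V"
  using sub_div sub_closed by (force simp: isotropy_def)

lemma subgroup_isotropy:
  assumes "e \<in> fst ` V"
  shows "subgroup (isotropy V e) G"
proof
  show "isotropy V e \<subseteq> carrier G"
    using sub_closed by (auto simp: isotropy_def)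
  show one: "\<one> \<in> isotropy V e"
    using sub_one[OF assms] sub_closed by (auto simp: isotropy_def)
  have fix_inv: "\<theta> (inv g) e = e" if "g \<in> isotropy V e" for g
    using that sub_closed act_inv_act(1)[of g e] by (auto simp: isotropy_def)
  show inv: "inv g \<in> isotropy V e" if "g \<in> isotropy V e" for g
    using that fix_inv[OF that] sub_inv[of e g] by (simp add: isotropy_def)
  show "g \<otimes> h \<in> isotropy V e" if "g \<in> isotropy V e" "h \<in> isotropy V e" for g h
    using that sub_closed sub_extend[of e g e h] by (auto simp: isotropy_def act_mult)
qed

text \<open>Every arrow is a loop followed by a chosen arrow with the same ends. Finitely many
  objects leave finitely many isotropy groups to generate and finitely many arrows to
  choose.\<close>

lemma fg_if_fg_isotropy:
  assumes fin: "finite (fst ` V)"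
    and fg: "\<And>e. e \<in> fst ` V \<Longrightarrow> fg_subgroup G (isotropy V e)"
  shows "fg_inverse_subsemigroup S V"
proof -
  have "\<exists>C. finite C \<and> C \<subseteq> carrier G \<and> isotropy V e = generate G C" if "e \<in> fst ` V" for e
    using fg[OF that] by (simp add: fg_subgroup_def)
  then obtain C where C: "\<And>e. e \<in> fst ` V \<Longrightarrow> finite (C e)"
      "\<And>e. e \<in> fst ` V \<Longrightarrow> C e \<subseteq> carrier G"
      "\<And>e. e \<in> fst ` V \<Longrightarrow> isotropy V e = generate G (C e)"
    by metis
  \<comment> \<open>The identity \<open>(e, \<one>)\<close> must be supplied as a generator:
    \<open>C e\<close> may be empty, and \<open>inv_generate\<close>, unlike
    \<open>generate\<close>, produces nothing from the empty set.\<close>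
  define D where "D e = insert \<one> (C e)" for e
  define arrow where "arrow e f r \<longleftrightarrow> (e, r) \<in> V \<and> \<theta> (inv r) e = f" for e f r
  define r where "r e f = (SOME h. arrow e f h)" for e f
  have r: "arrow e f (r e f)" if "arrow e f g" for e f g
    unfolding r_def using that by (rule someI)
  \<comment> \<open>If no arrow joins \<open>e\<close> to \<open>f\<close>, then
    \<open>r e f\<close> is arbitrary; the membership condition in the second set keeps
    \<open>A\<close> inside \<open>V\<close>.\<close>
  define A where "A = (SIGMA e:fst ` V. D e) \<union>
    {(e, r e f) |e f. e \<in> fst ` V \<and> f \<in> fst ` V \<and> (e, r e f) \<in> V}"
  have "finite (SIGMA e:fst ` V. D e)"
    using fin C(1) by (intro finite_SigmaI) (auto simp: D_def)
  moreover have "finite {(e, r e f) |e f. e \<in> fst ` V \<and> f \<in> fst ` V \<and> (e, r e f) \<in> V}"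
    by (rule finite_subset[of _ "(\<lambda>(e, f). (e, r e f)) ` (fst ` V \<times> fst ` V)"]) (use fin in auto)
  ultimately have "finite A" by (simp add: A_def)
  have D: "D e \<subseteq> isotropy V e" if "e \<in> fst ` V" for e
    using C(3)[OF that] generate.incl[of _ "C e" G] generate.one[of G "C e"]
    by (auto simp: D_def)
  then have AV: "A \<subseteq> V"
    by (auto simp: A_def isotropy_def)
  have iso: "(e, g) \<in> inv_generate S A" if e: "e \<in> fst ` V" and g: "g \<in> isotropy V e" for e g
  proof -
    have fixed: "g \<in> carrier G \<and> e \<in> carrier E \<and> \<theta> g e = e \<and> \<theta> (inv g) e = e"
      if "g \<in> generate G (C e)" for g
      using that subgroup.m_inv_closed[OF subgroup_isotropy[OF e]]
      unfolding C(3)[OF e, symmetric] isotropy_def by (auto dest: sub_closed)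
    have incl: "(e, d) \<in> inv_generate S A" if "d \<in> D e" for d
      using that e by (intro inv_generate.incl) (auto simp: A_def)
    have "g \<in> generate G (C e)" using g C(3)[OF e] by simp
    then show ?thesis
    proof induction
      case one
      show ?case by (rule incl) (simp add: D_def)
    next
      case (incl d)
      then show ?case by (intro \<open>\<And>d. d \<in> D e \<Longrightarrow> _\<close>) (simp add: D_def)
    next
      case (inv d)
      then have "d \<in> generate G (C e)" by (rule generate.incl)
      then have "sinv S (e, d) = (e, inv d)" by (simp add: fixed sinv_S)
      moreover have "(e, d) \<in> inv_generate S A"
        using inv by (intro incl) (simp add: D_def)
      ultimately show ?case by (metis inv_generate.inv)
    next
      case (eng g h)
      then have "(e, g) \<cdot>\<^bsub>S\<^esub> (e, h) = (e, g \<otimes> h)" by (simp add: mult_S fixed)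
      then show ?case using inv_generate.mult[OF eng.IH] by simp
    qed
  qed
  have "(e, g) \<in> inv_generate S A" if eg: "(e, g) \<in> V" for e g
  proof -
    note c = sub_closed[OF eg]
    define f where "f = \<theta> (inv g) e"
    have "arrow e f (r e f)"
      by (rule r[of _ _ g]) (use eg in \<open>simp add: arrow_def f_def\<close>)
    then have rV: "(e, r e f) \<in> V" and rf: "\<theta> (inv (r e f)) e = f"
      by (auto simp: arrow_def)
    have fV: "f \<in> fst ` V"
      using imageI[OF sub_inv[OF eg], of fst] by (simp add: f_def)
    have iso': "g \<otimes> inv (r e f) \<in> isotropy V e"
      using sub_div[OF eg rV] rf by (simp add: f_def)
    have eV: "e \<in> fst ` V" using imageI[OF eg, of fst] by simp
    have "(e, g \<otimes> inv (r e f)) \<in> inv_generate S A"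
      by (rule iso[OF eV iso'])
    moreover have "(e, r e f) \<in> inv_generate S A"
      using eV fV rV by (intro inv_generate.incl) (auto simp: A_def)
    ultimately have "(e, g \<otimes> inv (r e f)) \<cdot>\<^bsub>S\<^esub> (e, r e f) \<in> inv_generate S A"
      by (rule inv_generate.mult)
    moreover have "(e, g \<otimes> inv (r e f)) \<cdot>\<^bsub>S\<^esub> (e, r e f) = (e, g)"
      using iso' c sub_closed(2)[OF rV] by (simp add: mult_S isotropy_def m_assoc)
    ultimately show ?thesis by simp
  qed
  then have "V = inv_generate S A"
    using inv_generate_subset[OF V AV] by auto
  then show ?thesis
    using \<open>finite A\<close> AV V by (auto simp: fg_inverse_subsemigroup_def inverse_subsemigroup_def)
qed

end

section \<open>Finitely generated inverse subsemigroups under a locally finite action\<close>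

context
  assumes loc_fin: "locally_finite_action E G \<theta>"
begin

lemma finite_orbit:
  assumes "fg_subgroup G H" "e \<in> carrier E"
  shows "finite {\<theta> h e |h. h \<in> H}"
  using loc_fin assms by (simp add: locally_finite_action_def orbit_def)

text \<open>The second projection is a homomorphism, so the preimage of a subgroup of
  \<open>G\<close> is an inverse subsemigroup.\<close>

lemma snd_inv_generate:
  assumes "A \<subseteq> carrier S" "(e, g) \<in> inv_generate S A"
  shows "g \<in> generate G (snd ` A)"
proof -
  have A: "snd ` A \<subseteq> carrier G" using assms(1) by (auto simp: carrier_S)
  then interpret H: subgroup "generate G (snd ` A)" G by (rule generate_is_subgroup)
  have "inverse_subsemigroup S (carrier E \<times> generate G (snd ` A))"
    by (auto simp: inverse_subsemigroup_iff)
  moreover have "A \<subseteq> carrier E \<times> generate G (snd ` A)"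
    using assms(1) generate.incl[of _ "snd ` A" G] by (force simp: carrier_S)
  ultimately show ?thesis
    using inv_generate_subset assms(2) by blast
qed

lemma fg_generate_snd:
  assumes "finite A" "A \<subseteq> carrier S"
  shows "fg_subgroup G (generate G (snd ` A))"
  unfolding fg_subgroup_def using assms by (intro exI[of _ "snd ` A"]) (auto simp: carrier_S)

text \<open>The first components are finite meets of elements of finitely many
  \<open>H\<close>-orbits, which are finite. Instead of forming these meets, the proof confines the
  first components to a set \<open>Q\<close> that is closed under meets and under
  \<open>H\<close>.\<close>

lemma finite_fst_inv_generate:
  assumes A: "finite A" "A \<subseteq> carrier S"
  shows "finite (fst ` inv_generate S A)"
proof -
  define H where "H = generate G (snd ` A)"
  have fg: "fg_subgroup G H" unfolding H_def using A by (rule fg_generate_snd)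
  then interpret H: subgroup H G by (rule fg_subgroupD[OF is_group])
  define O' where "O' = (\<Union>p\<in>A. {\<theta> h (fst p) |h. h \<in> H})"
  have fin: "finite O'"
    unfolding O'_def using A finite_orbit[OF fg] by (auto simp: carrier_S)
  have O'E: "O' \<subseteq> carrier E"
    using A by (auto simp: O'_def carrier_S)
  have O'H: "\<theta> h x \<in> O'" if hx: "h \<in> H" "x \<in> O'" for h x
  proof -
    from hx obtain p k where p: "p \<in> A" "k \<in> H" "x = \<theta> k (fst p)"
      by (auto simp: O'_def)
    then have "\<theta> h x = \<theta> (h \<otimes> k) (fst p)"
      using hx A by (auto simp: act_mult carrier_S)
    then show ?thesis using p hx by (auto simp: O'_def)
  qed
  \<comment> \<open>\<open>x\<close> is the greatest lower bound of the elements of \<open>O'\<close> above it; such \<open>x\<close> are finite in number.\<close>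
  define Q where "Q x \<longleftrightarrow> x \<in> carrier E \<and>
    (\<forall>z\<in>carrier E. (\<forall>y\<in>O'. x \<sqsubseteq>\<^bsub>E\<^esub> y \<longrightarrow> z \<sqsubseteq>\<^bsub>E\<^esub> y) \<longrightarrow> z \<sqsubseteq>\<^bsub>E\<^esub> x)" for x
  have Q_O': "Q x" if "x \<in> O'" for x
    using that O'E by (auto simp: Q_def)
  have Q_act: "Q (\<theta> h x)" if h: "h \<in> H" and x: "Q x" for h x
    unfolding Q_def
  proof (intro conjI ballI impI)
    have xE: "x \<in> carrier E" using x by (simp add: Q_def)
    then show "\<theta> h x \<in> carrier E" using h by simp
    fix z assume z: "z \<in> carrier E" and le: "\<forall>y\<in>O'. \<theta> h x \<sqsubseteq>\<^bsub>E\<^esub> y \<longrightarrow> z \<sqsubseteq>\<^bsub>E\<^esub> y"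
    \<comment> \<open>\<open>O'\<close> is stable under \<open>H\<close>, so an element of
      \<open>O'\<close> above \<open>x\<close> is moved by \<open>h\<close> to an element of
      \<open>O'\<close> above \<open>\<theta> h x\<close>.\<close>
    have "\<theta> (inv h) z \<sqsubseteq>\<^bsub>E\<^esub> y" if y: "y \<in> O'" "x \<sqsubseteq>\<^bsub>E\<^esub> y" for y
      using y le O'H[OF h y(1)] act_le[of h x y] act_le_iff[of h z y] h xE z O'E by auto
    then have "\<theta> (inv h) z \<sqsubseteq>\<^bsub>E\<^esub> x"
      using x z h by (simp add: Q_def)
    then show "z \<sqsubseteq>\<^bsub>E\<^esub> \<theta> h x"
      using act_le_iff[of h z x] h z xE by simp
  qed
  have Q_meet: "Q (x \<sqinter>\<^bsub>E\<^esub> y)" if x: "Q x" and y: "Q y" for x y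
    unfolding Q_def
  proof (intro conjI ballI impI)
    have c: "x \<in> carrier E" "y \<in> carrier E" using x y by (auto simp: Q_def)
    then show "x \<sqinter>\<^bsub>E\<^esub> y \<in> carrier E" by simp
    fix z assume z: "z \<in> carrier E" and le: "\<forall>w\<in>O'. x \<sqinter>\<^bsub>E\<^esub> y \<sqsubseteq>\<^bsub>E\<^esub> w \<longrightarrow> z \<sqsubseteq>\<^bsub>E\<^esub> w"
    have "z \<sqsubseteq>\<^bsub>E\<^esub> w" if w: "w \<in> O'" "x \<sqsubseteq>\<^bsub>E\<^esub> w \<or> y \<sqsubseteq>\<^bsub>E\<^esub> w" for w
    proof -
      have "x \<sqinter>\<^bsub>E\<^esub> y \<sqsubseteq>\<^bsub>E\<^esub> w"
        using w O'E c le_trans[of "x \<sqinter>\<^bsub>E\<^esub> y" x w] le_trans[of "x \<sqinter>\<^bsub>E\<^esub> y" y w]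
        by (auto simp: meet_left meet_right)
      then show ?thesis using le w by blast
    qed
    then have "z \<sqsubseteq>\<^bsub>E\<^esub> x" "z \<sqsubseteq>\<^bsub>E\<^esub> y"
      using x y z by (auto simp: Q_def)
    then show "z \<sqsubseteq>\<^bsub>E\<^esub> x \<sqinter>\<^bsub>E\<^esub> y" using c z by (simp add: meet_le)
  qed
  have "inverse_subsemigroup S ({x. Q x} \<times> H)"
    by (auto simp: inverse_subsemigroup_iff Q_act Q_meet) (simp add: Q_def)
  moreover have "A \<subseteq> {x. Q x} \<times> H"
  proof
    fix p assume p: "p \<in> A"
    then have "fst p = \<theta> \<one> (fst p)" using A by (auto simp: carrier_S)
    then have "fst p \<in> O'" using p H.one_closed unfolding O'_def by blast
    moreover have "snd p \<in> H" using p by (simp add: H_def generate.incl)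
    ultimately show "p \<in> {x. Q x} \<times> H" by (cases p) (simp add: Q_O')
  qed
  ultimately have "inv_generate S A \<subseteq> {x. Q x} \<times> H"
    by (rule inv_generate_subset)
  then have "fst ` inv_generate S A \<subseteq> {x. Q x}" by auto
  \<comment> \<open>Elements of \<open>Q\<close> with the same upper bounds in \<open>O'\<close> lie
    below each other, so there are at most as many as subsets of \<open>O'\<close>.\<close>
  moreover have "inj_on (\<lambda>x. {y \<in> O'. x \<sqsubseteq>\<^bsub>E\<^esub> y}) {x. Q x}"
  proof (rule inj_onI)
    fix x y assume xy: "x \<in> {x. Q x}" "y \<in> {x. Q x}"
      and eq: "{z \<in> O'. x \<sqsubseteq>\<^bsub>E\<^esub> z} = {z \<in> O'. y \<sqsubseteq>\<^bsub>E\<^esub> z}"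
    have "x \<sqsubseteq>\<^bsub>E\<^esub> z \<longleftrightarrow> y \<sqsubseteq>\<^bsub>E\<^esub> z" if "z \<in> O'" for z
      using eq that by blast
    then show "x = y" using xy by (auto simp: Q_def intro: le_antisym)
  qed
  then have "finite {x. Q x}"
    by (rule inj_on_finite[of _ _ "Pow O'"]) (use fin in auto)
  ultimately show ?thesis by (rule finite_subset)
qed

text \<open>Schreier's argument on a finite graph: the vertices are the objects connected to
  \<open>e\<close>, the edges come from the generators in \<open>A\<close>, and a loop at
  \<open>e\<close> is rewritten edge by edge by returning to \<open>e\<close> along the
  transversal.\<close>

lemma fg_isotropy:
  assumes A: "finite A" "A \<subseteq> carrier S" and T: "T = inv_generate S A" and eT: "e \<in> fst ` T"
  shows "fg_subgroup G (isotropy T e)"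
proof -
  have sub: "inverse_subsemigroup S T"
    unfolding T using A(2) by (rule inverse_subsemigroup_generate)
  note closed = sub_closed[OF sub]
  have e: "e \<in> carrier E" using eT closed by auto
  \<comment> \<open>The objects connected to \<open>e\<close>. They lie in the orbit of
    \<open>e\<close> under the subgroup generated by the second components of \<open>A\<close>,
    whence finiteness.\<close>
  define O' where "O' = {\<theta> (inv g) e |g. (e, g) \<in> T}"
  have "O' \<subseteq> {\<theta> h e |h. h \<in> generate G (snd ` A)}"
    using snd_inv_generate[OF A(2)] sub_inv[OF sub] by (fastforce simp: O'_def T)
  then have fin: "finite O'"
    using finite_orbit[OF fg_generate_snd[OF A] e] finite_subset by blast
  define t where "t f = (SOME g. (e, g) \<in> T \<and> \<theta> (inv g) e = f)" for f
  have t: "(e, t f) \<in> T \<and> \<theta> (inv (t f)) e = f" if "f \<in> O'" for f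
    unfolding t_def by (rule someI_ex) (use that in \<open>auto simp: O'_def\<close>)
  \<comment> \<open>Schreier generators for the transversal \<open>t\<close>; \<open>t e\<close> is added because it may differ from \<open>\<one>\<close>.\<close>
  define X where "X = insert (t e) ((\<lambda>(f, s). t f \<otimes> s \<otimes> inv (t (\<theta> (inv s) f))) ` (O' \<times> snd ` A))
    \<inter> isotropy T e"
  interpret I: subgroup "isotropy T e" G by (rule subgroup_isotropy[OF sub eT])
  have X: "finite X" "X \<subseteq> isotropy T e" "X \<subseteq> carrier G"
    using fin A I.subset by (auto simp: X_def)
  interpret N: subgroup "generate G X" G by (rule generate_is_subgroup[OF X(3)])
  \<comment> \<open>\<open>c g\<close> closes the arrow \<open>(e, g)\<close> to a loop at
    \<open>e\<close> by going back along the transversal.\<close>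
  define c where "c g = g \<otimes> inv (t (\<theta> (inv g) e))" for g
  have O': "\<theta> (inv g) e \<in> O'" if "(e, g) \<in> T" for g
    using that by (auto simp: O'_def)
  have c_carrier: "c g \<in> carrier G" if "(e, g) \<in> T" for g
    using closed(2)[OF that] closed(2)[of e] t[OF O'[OF that]] by (auto simp: c_def)
  \<comment> \<open>Continuing an arrow by \<open>p\<close> does not affect whether its closure lies
    in \<open>generate G X\<close>. The inequality says that \<open>p\<close> can be applied at the
    end of \<open>(e, g)\<close>. The starting point \<open>g\<close> varies so that products can be
    traversed factor by factor, and the equivalence serves the inverse case.\<close>
  have step: "\<forall>g. (e, g) \<in> T \<longrightarrow> e \<sqsubseteq>\<^bsub>E\<^esub> \<theta> g (fst p) \<longrightarrow>
      (c g \<in> generate G X \<longleftrightarrow> c (g \<otimes> snd p) \<in> generate G X)"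
    if "p \<in> inv_generate S A" for p
    using that
  proof induction
    case (incl p)
    obtain x s where p: "p = (x, s)" by (cases p)
    have xs: "x \<in> carrier E" "s \<in> carrier G" "s \<in> snd ` A" "(x, s) \<in> T"
      using incl A(2) inv_generate.incl[of p A S] by (force simp: p carrier_S T)+
    show ?case
    proof (intro allI impI)
      fix g assume g: "(e, g) \<in> T" and "e \<sqsubseteq>\<^bsub>E\<^esub> \<theta> g (fst p)"
      then have le: "e \<sqsubseteq>\<^bsub>E\<^esub> \<theta> g x" by (simp add: p)
      have gG: "g \<in> carrier G" using closed[OF g] by simp
      have gs: "(e, g \<otimes> s) \<in> T" by (rule sub_extend[OF sub g xs(4) le])
      define f f' where "f = \<theta> (inv g) e" and "f' = \<theta> (inv s) f"
      have f': "f' = \<theta> (inv (g \<otimes> s)) e"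
        using gG xs e by (simp add: f'_def f_def act_mult inv_mult_group)
      note tf = t[OF O'[OF g], folded f_def] and tf' = t[OF O'[OF gs], folded f']
      have tG: "t f \<in> carrier G" "t f' \<in> carrier G" using tf tf' closed by auto
      have "f \<sqsubseteq>\<^bsub>E\<^esub> x" using le act_le_iff[of g e x] gG e xs by (simp add: f_def)
      then have "e \<sqsubseteq>\<^bsub>E\<^esub> \<theta> (t f) x"
        using tf act_le_iff[of "t f" e x] tG e xs by simp
      then have ts: "(e, t f \<otimes> s) \<in> T"
        using sub_extend[OF sub _ xs(4)] tf by blast
      have "\<theta> (inv (t f \<otimes> s)) e = \<theta> (inv (t f')) e"
        using tf tf' tG xs e by (simp add: act_mult inv_mult_group f'_def)
      then have n: "t f \<otimes> s \<otimes> inv (t f') \<in> isotropy T e"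
        using sub_div[OF sub ts] tf' by blast
      \<comment> \<open>Being a loop at \<open>e\<close>, this Schreier product survives the
        intersection with \<open>isotropy T e\<close> in the definition of \<open>X\<close>.\<close>
      have "t f \<otimes> s \<otimes> inv (t f') \<in> X"
        using n O'[OF g] xs(3) unfolding X_def f'_def f_def by force
      then have n': "t f \<otimes> s \<otimes> inv (t f') \<in> generate G X" by (rule generate.incl)
      have cg: "c g = g \<otimes> inv (t f)" "c (g \<otimes> s) = g \<otimes> s \<otimes> inv (t f')"
        by (simp_all add: c_def f_def flip: f')
      have "c (g \<otimes> s) = c g \<otimes> (t f \<otimes> s \<otimes> inv (t f'))"
        using gG tG xs by (simp add: cg m_assoc inv_solve_left)
      then show "c g \<in> generate G X \<longleftrightarrow> c (g \<otimes> snd p) \<in> generate G X"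
        using n' c_carrier[OF g] by (simp add: p N.m_closed)
           (metis N.m_closed N.m_inv_closed N.mem_carrier inv_solve_right)
    qed
  next
    case (inv p)
    obtain x s where p: "p = (x, s)" by (cases p)
    have pT: "(x, s) \<in> T" using inv.hyps by (simp add: p T)
    note xs = closed[OF pT]
    show ?case
    proof (intro allI impI)
      fix g assume g: "(e, g) \<in> T" and "e \<sqsubseteq>\<^bsub>E\<^esub> \<theta> g (fst (sinv S p))"
      then have le: "e \<sqsubseteq>\<^bsub>E\<^esub> \<theta> g (\<theta> (inv s) x)" using xs by (simp add: p sinv_S)
      have gG: "g \<in> carrier G" using closed[OF g] by simp
      \<comment> \<open>The hypothesis for \<open>p\<close> is applied at
        \<open>g \<otimes> inv s\<close>, from which \<open>p\<close> leads back to
        \<open>g\<close>, and is then read from right to left.\<close>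
      have "(e, g \<otimes> inv s) \<in> T" by (rule sub_extend[OF sub g sub_inv[OF sub pT] le])
      moreover have "e \<sqsubseteq>\<^bsub>E\<^esub> \<theta> (g \<otimes> inv s) x" using le gG xs by (simp add: act_mult)
      ultimately have "c (g \<otimes> inv s) \<in> generate G X \<longleftrightarrow> c (g \<otimes> inv s \<otimes> s) \<in> generate G X"
        using inv.IH by (simp add: p)
      then show "c g \<in> generate G X \<longleftrightarrow> c (g \<otimes> snd (sinv S p)) \<in> generate G X"
        using gG xs by (simp add: p sinv_S m_assoc)
    qed
  next
    case (mult p q)
    obtain x s y u where pq: "p = (x, s)" "q = (y, u)" by (cases p, cases q)
    have pT: "(x, s) \<in> T" and qT: "(y, u) \<in> T" using mult.hyps by (simp_all add: pq T)
    note xs = closed[OF pT] and yu = closed[OF qT]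
    show ?case
    proof (intro allI impI)
      fix g assume g: "(e, g) \<in> T" and "e \<sqsubseteq>\<^bsub>E\<^esub> \<theta> g (fst (p \<cdot>\<^bsub>S\<^esub> q))"
      then have le: "e \<sqsubseteq>\<^bsub>E\<^esub> \<theta> g x \<sqinter>\<^bsub>E\<^esub> \<theta> g (\<theta> s y)"
        using closed[OF g] xs yu by (simp add: pq mult_S act_meet)
      have gG: "g \<in> carrier G" using closed[OF g] by simp
      \<comment> \<open>The bound by the meet splits: \<open>p\<close> can be applied after
        \<open>g\<close>, and \<open>q\<close> after \<open>g \<otimes> s\<close>.\<close>
      have le1: "e \<sqsubseteq>\<^bsub>E\<^esub> \<theta> g x" and le2: "e \<sqsubseteq>\<^bsub>E\<^esub> \<theta> (g \<otimes> s) y"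
        using le_trans[OF le meet_left] le_trans[OF le meet_right] e gG xs yu
        by (simp_all add: act_mult)
      have gs: "(e, g \<otimes> s) \<in> T" by (rule sub_extend[OF sub g pT le1])
      show "c g \<in> generate G X \<longleftrightarrow> c (g \<otimes> snd (p \<cdot>\<^bsub>S\<^esub> q)) \<in> generate G X"
        using mult.IH g gs le1 le2 gG xs yu by (simp add: pq mult_S m_assoc)
    qed
  qed
  have one: "(e, \<one>) \<in> T" by (rule sub_one[OF sub eT])
  have "e \<in> O'" using O'[OF one] e by simp
  note te = t[OF this]
  have teG: "t e \<in> carrier G" using te closed by auto
  have "\<theta> (t e) e = e" using te act_inv_act(2)[OF teG e] by simp
  then have "t e \<in> X" using te by (simp add: X_def isotropy_def)
  then have tN: "t e \<in> generate G X" by (rule generate.incl)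
  have "g \<in> generate G X" if g: "g \<in> isotropy T e" for g
  proof -
    have gT: "(e, g) \<in> T" and gG: "g \<in> carrier G" and ge: "\<theta> g e = e"
      using g closed by (auto simp: isotropy_def)
    have ge': "\<theta> (inv g) e = e" using act_inv_act(1)[OF gG e] ge by simp
    have "c \<one> \<in> generate G X" using tN teG e by (simp add: c_def)
    then have "c g \<in> generate G X"
      using step[of "(e, g)"] gT one e gG by (simp add: T)
    then have "g \<otimes> inv (t e) \<otimes> t e \<in> generate G X"
      using tN by (simp add: c_def ge')
    then show ?thesis using gG teG by (simp add: m_assoc)
  qed
  then have "isotropy T e = generate G X"
    using generate_subgroup_incl[OF X(2) I.subgroup_axioms] by auto
  then show ?thesis
    using X by (auto simp: fg_subgroup_def)
qed

section \<open>Transfer of the Howson property in both directions\<close>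

lemma howson_inverse_semigroup_S:
  assumes "howson_group G"
  shows "howson_inverse_semigroup S"
proof (intro howson_inverse_semigroup.intro howson_inverse_semigroup_axioms.intro)
  show "inverse_semigroup S" by (rule inverse_semigroup_S)
  fix T U assume "fg_inverse_subsemigroup S T" "fg_inverse_subsemigroup S U"
  then obtain A B where A: "finite A" "A \<subseteq> carrier S" and T: "T = inv_generate S A"
    and B: "finite B" "B \<subseteq> carrier S" and U: "U = inv_generate S B"
    by (auto simp: fg_inverse_subsemigroup_def)
  show "fg_inverse_subsemigroup S (T \<inter> U)"
  proof (rule fg_if_fg_isotropy)
    show "inverse_subsemigroup S (T \<inter> U)"
      unfolding T U using A B by (intro inverse_subsemigroup_Int inverse_subsemigroup_generate)
    show "finite (fst ` (T \<inter> U))"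
      using finite_fst_inv_generate[OF A] by (rule rev_finite_subset) (auto simp: T)
    fix e assume "e \<in> fst ` (T \<inter> U)"
    then have "e \<in> fst ` T" "e \<in> fst ` U" by auto
    then have "fg_subgroup G (isotropy T e \<inter> isotropy U e)"
      using fg_isotropy[OF A T] fg_isotropy[OF B U] howson_group.fg_Int[OF assms] by blast
    also have "isotropy T e \<inter> isotropy U e = isotropy (T \<inter> U) e"
      by (auto simp: isotropy_def)
    finally show "fg_subgroup G (isotropy (T \<inter> U) e)" .
  qed
qed

text \<open>Each \<open>h\<close> permutes the orbit of \<open>x\<close>, so it sends the meet
  \<open>f\<close> of the orbit to a lower bound of the orbit, hence below \<open>f\<close>. The
  same inequality for \<open>inv h\<close> gives equality.\<close>

lemma ex_fixed_point:
  assumes "fg_subgroup G H" "x \<in> carrier E"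
  shows "\<exists>f\<in>carrier E. \<forall>h\<in>H. \<theta> h f = f"
proof -
  interpret H: subgroup H G by (rule fg_subgroupD[OF is_group assms(1)])
  define O' where "O' = {\<theta> h x |h. h \<in> H}"
  have O': "finite O'" "O' \<subseteq> carrier E" "O' \<noteq> {}"
    using finite_orbit[OF assms] assms(2) H.one_closed unfolding O'_def by (simp, force, blast)
  define f where "f = \<Sqinter>\<^bsub>E\<^esub> O'"
  have g: "greatest E f (Lower E O')"
    unfolding f_def using O' by (rule finite_inf_greatest)
  then have f: "f \<in> carrier E" by simp
  have below: "f \<sqsubseteq>\<^bsub>E\<^esub> y" if "y \<in> O'" for y
    using g that O' by (auto simp: greatest_def Lower_def)
  have le: "\<theta> h f \<sqsubseteq>\<^bsub>E\<^esub> f" if h: "h \<in> H" for h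
  proof -
    have "\<theta> h f \<sqsubseteq>\<^bsub>E\<^esub> y" if "y \<in> O'" for y
    proof -
      from that obtain k where k: "k \<in> H" "y = \<theta> k x" by (auto simp: O'_def)
      then have "y = \<theta> h (\<theta> (inv h \<otimes> k) x)"
        using h assms(2) by (simp add: act_mult)
      moreover have "\<theta> (inv h \<otimes> k) x \<in> O'"
        using h k by (auto simp: O'_def)
      ultimately show ?thesis using below O' h f by (auto intro!: act_le)
    qed
    then show ?thesis using g h f by (auto simp: greatest_def Lower_def)
  qed
  have "\<theta> h f = f" if h: "h \<in> H" for h
    using le[OF h] le[of "inv h"] act_le_iff[of h f f] h f by (auto intro: le_antisym)
  then show ?thesis using f by blast
qed

text \<open>As a groupoid this has the single object \<open>f\<close>, with isotropy group
  \<open>H\<close>.\<close>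

lemma fg_times_subgroup:
  assumes H: "fg_subgroup G H" and f: "f \<in> carrier E" "\<And>h. h \<in> H \<Longrightarrow> \<theta> h f = f"
  shows "fg_inverse_subsemigroup S ({f} \<times> H)"
proof (rule fg_if_fg_isotropy)
  interpret H: subgroup H G by (rule fg_subgroupD[OF is_group H])
  show "inverse_subsemigroup S ({f} \<times> H)"
    using f by (auto simp: inverse_subsemigroup_iff)
  show "finite (fst ` ({f} \<times> H))"
    by (rule finite_subset[of _ "{f}"]) auto
  fix e assume "e \<in> fst ` ({f} \<times> H)"
  then have "e = f" by (auto simp only: fst_conv)
  then have "isotropy ({f} \<times> H) e = H" using f by (auto simp: isotropy_def)
  then show "fg_subgroup G (isotropy ({f} \<times> H) e)" using H by simp
qed

lemma howson_group_G:
  assumes "howson_inverse_semigroup S" and ne: "carrier E \<noteq> {}"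
  shows "howson_group G"
proof (intro howson_group.intro howson_group_axioms.intro is_group)
  fix H K assume H: "fg_subgroup G H" and K: "fg_subgroup G K"
  then obtain A B where A: "finite A" "A \<subseteq> carrier G" "H = generate G A"
    and B: "finite B" "B \<subseteq> carrier G" "K = generate G B"
    by (auto simp: fg_subgroup_def)
  \<comment> \<open>One point fixed by both \<open>H\<close> and \<open>K\<close> is needed; it
    comes from the subgroup that they generate together.\<close>
  have "fg_subgroup G (generate G (A \<union> B))"
    using A B by (auto simp: fg_subgroup_def)
  then obtain f where f: "f \<in> carrier E" "\<And>h. h \<in> generate G (A \<union> B) \<Longrightarrow> \<theta> h f = f"
    using ex_fixed_point ne by blast
  have "H \<subseteq> generate G (A \<union> B)" "K \<subseteq> generate G (A \<union> B)"
    unfolding A B by (rule mono_generate, simp)+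
  then have fH: "\<theta> h f = f" if "h \<in> H \<union> K" for h using f that by blast
  have "fg_inverse_subsemigroup S ({f} \<times> H \<inter> {f} \<times> K)"
    using howson_inverse_semigroup.fg_Int[OF assms(1)] fg_times_subgroup H K f(1) fH by simp
  also have "{f} \<times> H \<inter> {f} \<times> K = {f} \<times> (H \<inter> K)" by auto
  finally obtain C where C: "finite C" "C \<subseteq> carrier S" "{f} \<times> (H \<inter> K) = inv_generate S C"
    by (auto simp: fg_inverse_subsemigroup_def)
  have "isotropy (inv_generate S C) f = H \<inter> K"
    using fH by (auto simp: isotropy_def simp flip: C(3))
  \<comment> \<open>The identity of \<open>G\<close> lies in both subgroups, so \<open>f\<close>
    does occur as an object.\<close>
  moreover have "f \<in> fst ` inv_generate S C"
    using fg_subgroupD[OF is_group H] fg_subgroupD[OF is_group K]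
    by (force simp flip: C(3) dest: subgroup.one_closed)
  ultimately show "fg_subgroup G (H \<inter> K)"
    using fg_isotropy[OF C(1,2) HOL.refl] by metis
qed

end

end

theorem corollary4p1:
  fixes E :: "('e, 'm) gorder_scheme"
    and G :: "('g, 'n) monoid_scheme"
    and \<theta> :: "'g \<Rightarrow> 'e \<Rightarrow> 'e"
  assumes "lower_semilattice E" and "carrier E \<noteq> {}"
    and "group G"
    and "group_hom G (MeetAutoGroup E) \<theta>"
    and "locally_finite_action E G \<theta>"
  shows "howson_inverse_semigroup (semidirect_product E G \<theta>) \<longleftrightarrow> howson_group G"
proof -
  interpret semilattice_action E G \<theta>
    using assms by (intro semilattice_action.intro semilattice_action_axioms.intro)
  show ?thesis
    using howson_inverse_semigroup_S howson_group_G assms by blast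
qed

end
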